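(* Let $\Omega\subseteq\mathbb{C}$ be a domain and let $$\mathcal{L}(\lambda)=\begin{pmatrix}A(\lambda)&B(\lambda)\\C(\lambda)&D(\lambda)\end{pmatrix},\quad\operatorname{dom}\mathcal{L}(\lambda)=\big(\operatorname{dom}A(\lambda)\cap\operatorname{dom}C(\lambda)\big)\oplus\big(\operatorname{dom}B(\lambda)\cap\operatorname{dom}D(\lambda)\big),\quad\lambda\in\Omega,$$ be a family of operator matrices in $\mathcal{H}=\mathcal{H}_1\oplus\mathcal{H}_2$ with Schur complements $S_1$, $S_2$. If $\lambda\in\sigma_{\mathrm{ap}}(\mathcal{L})\setminus(\sigma(A)\cup\sigma(D))$ is such that one of the conditions (i) $C(\lambda)$ is $A(\lambda)$-bounded and $B(\lambda)$ is $D(\lambda)$-bounded; (ii) $A(\lambda)$ is $C(\lambda)$-bounded, $D(\lambda)$ is $B(\lambda)$-bounded and both $C(\lambda)$ and $B(\lambda)$ are boundedly invertible; is satisfied, then $\lambda\in\sigma_{\mathrm{ap}}(S_1)\cup\sigma_{\mathrm{ap}}(S_2)$. If for all $\lambda\in\rho(A)\cap\rho(D)$ one of the conditions (i) or (ii) is satisfied, then $$\sigma_{\mathrm{ap}}(\mathcal{L})\setminus(\sigma(A)\cup\sigma(D))\subseteq\sigma_{\mathrm{ap}}(S_1)\cup\sigma_{\mathrm{ap}}(S_2)\subseteq W_\Psi(S_1)\cup W_\Psi(S_2)\subseteq W^2_{\Psi,2}(\mathcal{L})\subseteq W^2_\Psi(\mathcal{L}).$$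
   Context: $\mathcal{H}_1,\mathcal{H}_2$ are nonzero complex Hilbert spaces. Each $\mathcal{L}(\lambda)$ is densely defined, and $A(\lambda)$ in $\mathcal{H}_1$, $B(\lambda)$ from $\mathcal{H}_2$ to $\mathcal{H}_1$, $C(\lambda)$ from $\mathcal{H}_1$ to $\mathcal{H}_2$, $D(\lambda)$ in $\mathcal{H}_2$ are densely defined closable linear operators. Write $\mathcal{D}_1(\lambda)=\operatorname{dom}A(\lambda)\cap\operatorname{dom}C(\lambda)$, $\mathcal{D}_2(\lambda)=\operatorname{dom}B(\lambda)\cap\operatorname{dom}D(\lambda)$. An operator $S$ is $T$-bounded if $\operatorname{dom}T\subseteq\operatorname{dom}S$ and there are $a,b\ge0$ with $\|Sx\|\le a\|x\|+b\|Tx\|$, $x\in\operatorname{dom}T$. "Boundedly invertible" means bijective from the domain onto the target space with bounded inverse. For an operator family $T(\lambda)$, $\lambda\in\Omega'$, on a set $\Omega'\subseteq\mathbb{C}$: $\sigma(T)=\{\lambda\in\Omega':0\in\sigma(T(\lambda))\}$, $\rho(T)=\Omega'\setminus\sigma(T)$, $\sigma_{\mathrm{ap}}(T)=\{\lambda\in\Omega':\exists(f_n)_n\subseteq\operatorname{dom}T(\lambda),\|f_n\|=1,T(\lambda)f_n\to0\}$, $W(T)=\{\lambda\in\Omega':\exists f\in\operatorname{dom}T(\lambda),f\ne0,(T(\lambda)f,f)=0\}$, and the pseudo numerical range is $W_\Psi(T)=\bigcap_{\varepsilon>0}\bigcup_{B\ \text{bounded},\|B\|<\varepsilon}W(T+B)$.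 Schur complements: $S_1(\lambda)=A(\lambda)-B(\lambda)D(\lambda)^{-1}C(\lambda)$, $\operatorname{dom}S_1(\lambda)=\{f\in\mathcal{D}_1(\lambda):D(\lambda)^{-1}C(\lambda)f\in\operatorname{dom}B(\lambda)\}$, for $\lambda\in\rho(D)$ (family on $\rho(D)$); $S_2(\lambda)=D(\lambda)-C(\lambda)A(\lambda)^{-1}B(\lambda)$, $\operatorname{dom}S_2(\lambda)=\{f\in\mathcal{D}_2(\lambda):A(\lambda)^{-1}B(\lambda)f\in\operatorname{dom}C(\lambda)\}$, for $\lambda\in\rho(A)$ (family on $\rho(A)$). Quadratic numerical range: for a family $\mathcal{L}(\lambda)=\begin{pmatrix}A(\lambda)&B(\lambda)\\C(\lambda)&D(\lambda)\end{pmatrix}$, $\lambda\in\Omega$, of densely defined operator matrices in $\mathcal{H}_1\oplus\mathcal{H}_2$ with densely defined closable entries and $\operatorname{dom}\mathcal{L}(\lambda)=\mathcal{D}_1(\lambda)\oplus\mathcal{D}_2(\lambda)$, $W^2(\mathcal{L})$ is the set of $\lambda\in\Omega$ for which there are unit vectors $f\in\mathcal{D}_1(\lambda)$, $g\in\mathcal{D}_2(\lambda)$ with $\det\begin{pmatrix}(A(\lambda)f,f)&(B(\lambda)g,f)\\(C(\lambda)f,g)&(D(\lambda)g,g)\end{pmatrix}=0$. Pseudo quadratic numerical range: $W^2_\Psi(\mathcal{L})=\bigcap_{\varepsilon>0}\bigcup_{\mathcal{B}\in L(\mathcal{H}),\|\mathcal{B}\|<\varepsilon}W^2(\mathcal{L}+\mathcal{B})$.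 Further, $W^2_{\Psi,2}(\mathcal{L})=\bigcap_{\varepsilon>0}\bigcup_{B_i\in L(\mathcal{H}_i),\|B_i\|<\varepsilon}W^2(\mathcal{L}+\operatorname{diag}(B_1,B_2))$. *)

theory Defs
  imports "HOL-Analysis.Analysis"
begin

section \<open>Complex Hilbert spaces\<close>

text \<open>The inner product is linear in the first argument.\<close>

class complex_inner = real_normed_vector +
  fixes scaleC :: "complex \<Rightarrow> 'a \<Rightarrow> 'a" (infixr \<open>*\<^sub>C\<close> 75)
    and cinner :: "'a \<Rightarrow> 'a \<Rightarrow> complex"
  assumes scaleC_add_right: "a *\<^sub>C (x + y) = a *\<^sub>C x + a *\<^sub>C y"
    and scaleC_add_left: "(a + b) *\<^sub>C x = a *\<^sub>C x + b *\<^sub>C x"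
    and scaleC_scaleC: "a *\<^sub>C (b *\<^sub>C x) = (a * b) *\<^sub>C x"
    and scaleC_one: "1 *\<^sub>C x = x"
    and scaleR_scaleC: "r *\<^sub>R x = complex_of_real r *\<^sub>C x"
    and cinner_commute: "cinner x y = cnj (cinner y x)"
    and cinner_add_left: "cinner (x + y) z = cinner x z + cinner y z"
    and cinner_scaleC_left: "cinner (a *\<^sub>C x) y = a * cinner x y"
    and cinner_self: "cinner x x = complex_of_real ((norm x)\<^sup>2)"

class complex_hilbert = complex_inner + banach

global_interpretation complex_vector:
  vector_space "scaleC :: complex \<Rightarrow> 'a \<Rightarrow> 'a::complex_inner"
  by unfold_locales
    (fact scaleC_add_right scaleC_add_left scaleC_scaleC scaleC_one)+

text \<open>The orthogonal sum of two Hilbert spaces is the product type, whose library norm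
  is already the Hilbert norm of the direct sum.\<close>

instantiation prod :: (complex_inner, complex_inner) complex_inner
begin

definition scaleC_prod :: "complex \<Rightarrow> 'a \<times> 'b \<Rightarrow> 'a \<times> 'b"
  where "scaleC_prod c x = (c *\<^sub>C fst x, c *\<^sub>C snd x)"

definition cinner_prod :: "'a \<times> 'b \<Rightarrow> 'a \<times> 'b \<Rightarrow> complex"
  where "cinner_prod x y = cinner (fst x) (fst y) + cinner (snd x) (snd y)"

instance
proof
  fix a b :: complex and r :: real and x y z :: "'a \<times> 'b"
  show "a *\<^sub>C (x + y) = a *\<^sub>C x + a *\<^sub>C y" "(a + b) *\<^sub>C x = a *\<^sub>C x + b *\<^sub>C x"
    "a *\<^sub>C b *\<^sub>C x = (a * b) *\<^sub>C x" "1 *\<^sub>C x = x"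
    by (simp_all add: scaleC_prod_def scaleC_add_right scaleC_add_left scaleC_scaleC scaleC_one)
  show "r *\<^sub>R x = complex_of_real r *\<^sub>C x"
    by (simp add: scaleC_prod_def scaleR_prod_def scaleR_scaleC)
  show "cinner x y = cnj (cinner y x)"
    using cinner_commute[of "fst x" "fst y"] cinner_commute[of "snd x" "snd y"]
    by (simp add: cinner_prod_def)
  show "cinner (x + y) z = cinner x z + cinner y z" "cinner (a *\<^sub>C x) y = a * cinner x y"
    by (simp_all add: cinner_prod_def scaleC_prod_def cinner_add_left cinner_scaleC_left
        algebra_simps)
  show "cinner x x = complex_of_real ((norm x)\<^sup>2)"
    by (simp add: cinner_prod_def cinner_self norm_prod_def)
qed

end

instance prod :: (complex_hilbert, complex_hilbert) complex_hilbert ..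

section \<open>Unbounded operators\<close>

text \<open>An operator is a domain together with a function; the values of the function outside
  the domain are irrelevant. Linearity is the separate predicate \<open>linear_operator\<close>.\<close>

datatype ('a, 'b) operator = Operator (op_dom: "'a set") (op_app: "'a \<Rightarrow> 'b")

definition linear_operator :: "('a::complex_inner, 'b::complex_inner) operator \<Rightarrow> bool"
  where "linear_operator T \<longleftrightarrow> complex_vector.subspace (op_dom T) \<and>
    (\<forall>x\<in>op_dom T. \<forall>y\<in>op_dom T. op_app T (x + y) = op_app T x + op_app T y) \<and>
    (\<forall>c. \<forall>x\<in>op_dom T. op_app T (c *\<^sub>C x) = c *\<^sub>C op_app T x)"

definition densely_defined :: "('a::complex_inner, 'b::complex_inner) operator \<Rightarrow> bool"
  where "densely_defined T \<longleftrightarrow> closure (op_dom T) = UNIV"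

definition op_graph :: "('a::complex_inner, 'b::complex_inner) operator \<Rightarrow> ('a \<times> 'b) set"
  where "op_graph T = {(x, op_app T x) | x. x \<in> op_dom T}"

definition closable_operator :: "('a::complex_inner, 'b::complex_inner) operator \<Rightarrow> bool"
  where "closable_operator T \<longleftrightarrow>
    (\<exists>S. linear_operator S \<and> closed (op_graph S) \<and> op_graph T \<subseteq> op_graph S)"

definition op_inv :: "('a::complex_inner, 'b::complex_inner) operator \<Rightarrow> 'b \<Rightarrow> 'a"
  where "op_inv T = inv_into (op_dom T) (op_app T)"

definition boundedly_invertible :: "('a::complex_inner, 'b::complex_inner) operator \<Rightarrow> bool"
  where "boundedly_invertible T \<longleftrightarrow> bij_betw (op_app T) (op_dom T) UNIV \<and>
    (\<exists>K. \<forall>y. norm (op_inv T y) \<le> K * norm y)"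

definition relatively_bounded ::
    "('a::complex_inner, 'b::complex_inner) operator \<Rightarrow> ('a, 'c::complex_inner) operator \<Rightarrow> bool"
    (infix \<open>bounded'_relative'_to\<close> 50)
  where "S bounded_relative_to T \<longleftrightarrow> op_dom T \<subseteq> op_dom S \<and>
    (\<exists>a\<ge>0. \<exists>b\<ge>0. \<forall>x\<in>op_dom T. norm (op_app S x) \<le> a * norm x + b * norm (op_app T x))"

definition op_spectrum :: "('a::complex_inner, 'a) operator \<Rightarrow> complex set"
  where "op_spectrum T =
    {z. \<not> boundedly_invertible (Operator (op_dom T) (\<lambda>x. op_app T x - z *\<^sub>C x))}"

text \<open>The everywhere defined bounded operators; the operator norm is the library's
  \<^const>\<open>onorm\<close>.\<close>

definition bounded_clinear :: "('a::complex_inner \<Rightarrow> 'b::complex_inner) \<Rightarrow> bool"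
  where "bounded_clinear B \<longleftrightarrow> bounded_linear B \<and> (\<forall>c x. B (c *\<^sub>C x) = c *\<^sub>C B x)"

definition op_plus ::
    "('a::complex_inner, 'b::complex_inner) operator \<Rightarrow> ('a \<Rightarrow> 'b) \<Rightarrow> ('a, 'b) operator"
  where "op_plus T B = Operator (op_dom T) (\<lambda>x. op_app T x + B x)"

section \<open>Operator families\<close>

text \<open>A family on \<open>\<Omega>\<close> is a function on the complex numbers of which only the values on \<open>\<Omega>\<close>
  matter. Each spectral set takes the index set \<open>\<Omega>\<close> of the family as an argument and is a
  subset of it.\<close>

definition fam_spectrum ::
    "complex set \<Rightarrow> (complex \<Rightarrow> ('a::complex_inner, 'a) operator) \<Rightarrow> complex set"
  where "fam_spectrum \<Omega> T = {z\<in>\<Omega>. 0 \<in> op_spectrum (T z)}"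

definition fam_resolvent_set ::
    "complex set \<Rightarrow> (complex \<Rightarrow> ('a::complex_inner, 'a) operator) \<Rightarrow> complex set"
  where "fam_resolvent_set \<Omega> T = \<Omega> - fam_spectrum \<Omega> T"

definition approx_point_spectrum ::
    "complex set \<Rightarrow> (complex \<Rightarrow> ('a::complex_inner, 'a) operator) \<Rightarrow> complex set"
  where "approx_point_spectrum \<Omega> T =
    {z\<in>\<Omega>. \<exists>f :: nat \<Rightarrow> 'a. (\<forall>n. f n \<in> op_dom (T z) \<and> norm (f n) = 1) \<and>
      (\<lambda>n. op_app (T z) (f n)) \<longlonglongrightarrow> 0}"

definition numerical_range ::
    "complex set \<Rightarrow> (complex \<Rightarrow> ('a::complex_inner, 'a) operator) \<Rightarrow> complex set"
  where "numerical_range \<Omega> T =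
    {z\<in>\<Omega>. \<exists>f\<in>op_dom (T z). f \<noteq> 0 \<and> cinner (op_app (T z) f) f = 0}"

definition pseudo_numerical_range ::
    "complex set \<Rightarrow> (complex \<Rightarrow> ('a::complex_inner, 'a) operator) \<Rightarrow> complex set"
  where "pseudo_numerical_range \<Omega> T =
    (\<Inter>\<epsilon>\<in>{0<..}. \<Union>B\<in>{B. bounded_clinear B \<and> onorm B < \<epsilon>}.
      numerical_range \<Omega> (\<lambda>z. op_plus (T z) B))"

section \<open>Operator matrices\<close>

datatype ('a, 'b) op_matrix = Op_Matrix
  (entry_A: "('a, 'a) operator") (entry_B: "('b, 'a) operator")
  (entry_C: "('a, 'b) operator") (entry_D: "('b, 'b) operator")

definition dom1 :: "('a, 'b) op_matrix \<Rightarrow> 'a set"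
  where "dom1 M = op_dom (entry_A M) \<inter> op_dom (entry_C M)"

definition dom2 :: "('a, 'b) op_matrix \<Rightarrow> 'b set"
  where "dom2 M = op_dom (entry_B M) \<inter> op_dom (entry_D M)"

definition matrix_operator ::
    "('a::complex_inner, 'b::complex_inner) op_matrix \<Rightarrow> ('a \<times> 'b, 'a \<times> 'b) operator"
  where "matrix_operator M = Operator (dom1 M \<times> dom2 M)
    (\<lambda>(f, g). (op_app (entry_A M) f + op_app (entry_B M) g,
              op_app (entry_C M) f + op_app (entry_D M) g))"

text \<open>The sum of an operator matrix and a bounded operator on the product space, the latter
  being decomposed into its four entries.\<close>

definition matrix_plus ::
    "('a::complex_inner, 'b::complex_inner) op_matrix \<Rightarrow> ('a \<times> 'b \<Rightarrow> 'a \<times> 'b) \<Rightarrow>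
      ('a, 'b) op_matrix"
  where "matrix_plus M B = Op_Matrix
    (op_plus (entry_A M) (\<lambda>f. fst (B (f, 0)))) (op_plus (entry_B M) (\<lambda>g. fst (B (0, g))))
    (op_plus (entry_C M) (\<lambda>f. snd (B (f, 0)))) (op_plus (entry_D M) (\<lambda>g. snd (B (0, g))))"

definition schur1 :: "('a::complex_inner, 'b::complex_inner) op_matrix \<Rightarrow> ('a, 'a) operator"
  where "schur1 M = Operator
    {f \<in> dom1 M. op_inv (entry_D M) (op_app (entry_C M) f) \<in> op_dom (entry_B M)}
    (\<lambda>f. op_app (entry_A M) f -
      op_app (entry_B M) (op_inv (entry_D M) (op_app (entry_C M) f)))"

definition schur2 :: "('a::complex_inner, 'b::complex_inner) op_matrix \<Rightarrow> ('b, 'b) operator"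
  where "schur2 M = Operator
    {g \<in> dom2 M. op_inv (entry_A M) (op_app (entry_B M) g) \<in> op_dom (entry_C M)}
    (\<lambda>g. op_app (entry_D M) g -
      op_app (entry_C M) (op_inv (entry_A M) (op_app (entry_B M) g)))"

definition quadratic_numerical_range ::
    "complex set \<Rightarrow> (complex \<Rightarrow> ('a::complex_inner, 'b::complex_inner) op_matrix) \<Rightarrow> complex set"
  where "quadratic_numerical_range \<Omega> L =
    {z\<in>\<Omega>. \<exists>f\<in>dom1 (L z). \<exists>g\<in>dom2 (L z). norm f = 1 \<and> norm g = 1 \<and>
      det (vector
        [vector [cinner (op_app (entry_A (L z)) f) f, cinner (op_app (entry_B (L z)) g) f],
         vector [cinner (op_app (entry_C (L z)) f) g, cinner (op_app (entry_D (L z)) g) g]]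
        :: complex ^ 2 ^ 2) = 0}"

definition pseudo_quadratic_numerical_range ::
    "complex set \<Rightarrow> (complex \<Rightarrow> ('a::complex_inner, 'b::complex_inner) op_matrix) \<Rightarrow> complex set"
  where "pseudo_quadratic_numerical_range \<Omega> L =
    (\<Inter>\<epsilon>\<in>{0<..}. \<Union>B\<in>{B. bounded_clinear B \<and> onorm B < \<epsilon>}.
      quadratic_numerical_range \<Omega> (\<lambda>z. matrix_plus (L z) B))"

text \<open>Here only block diagonal perturbations are admitted; \<open>map_prod B\<^sub>1 B\<^sub>2\<close> is the
  operator \<open>diag(B\<^sub>1, B\<^sub>2)\<close>.\<close>

definition diag_pseudo_quadratic_numerical_range ::
    "complex set \<Rightarrow> (complex \<Rightarrow> ('a::complex_inner, 'b::complex_inner) op_matrix) \<Rightarrow> complex set"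
  where "diag_pseudo_quadratic_numerical_range \<Omega> L =
    (\<Inter>\<epsilon>\<in>{0<..}. \<Union>B\<^sub>1\<in>{B. bounded_clinear B \<and> onorm B < \<epsilon>}.
      \<Union>B\<^sub>2\<in>{B. bounded_clinear B \<and> onorm B < \<epsilon>}.
        quadratic_numerical_range \<Omega> (\<lambda>z. matrix_plus (L z) (map_prod B\<^sub>1 B\<^sub>2)))"

end

theory Submission
  imports Defs
begin

text \<open>Write \<open>u = A f + B g\<close>, \<open>v = C f + D g\<close>. If \<open>B\<close> is \<open>D\<close>-bounded, then
  \<open>S\<^sub>1 f = u - B D\<^sup>-\<^sup>1 v\<close> with \<open>B D\<^sup>-\<^sup>1\<close> bounded; if \<open>A\<close> is \<open>C\<close>-bounded and \<open>C\<close> is boundedly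
  invertible, then \<open>f' = f - C\<^sup>-\<^sup>1 v\<close> lies in the domain of \<open>S\<^sub>1\<close> and
  \<open>S\<^sub>1 f' = u - A C\<^sup>-\<^sup>1 v\<close>. So if \<open>S\<^sub>1\<close> is bounded below, then \<open>\<parallel>f\<parallel>\<close> is controlled by
  \<open>\<parallel>u\<parallel> + \<parallel>v\<parallel>\<close>; by symmetry \<open>S\<^sub>2\<close> controls \<open>\<parallel>g\<parallel>\<close>, and both together exclude approximate
  null vectors of the matrix.
  An approximate null vector \<open>f\<close> of \<open>S\<^sub>1\<close> is turned into a zero of the numerical range by the
  small perturbation \<open>- (S\<^sub>1 f, f)\<close>. Finally, if \<open>((S\<^sub>1 + B\<^sub>1) f, f) = 0\<close>, then for
  \<open>g = D\<^sup>-\<^sup>1 C f\<close> the two columns of the \<open>2 \<times> 2\<close> matrix of \<open>\<L> + diag(B\<^sub>1, 0)\<close> at \<open>f, g\<close>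
  coincide; if \<open>g = 0\<close>, then \<open>C f = 0\<close> and its first column vanishes for any other choice of \<open>g\<close>.\<close>

section \<open>Inner products\<close>

lemma cinner_scaleC_right: "cinner x (a *\<^sub>C y) = cnj a * cinner x (y::'a::complex_inner)"
  using cinner_commute[of x "a *\<^sub>C y"] cinner_commute[of y x] by (simp add: cinner_scaleC_left)

lemma cinner_minus_left: "cinner (- x) y = - cinner x (y::'a::complex_inner)"
  using cinner_scaleC_left[of "-1" x y] by simp

lemma cinner_diff_left: "cinner (x - z) y = cinner x y - cinner z (y::'a::complex_inner)"
  using cinner_add_left[of x "- z" y] by (simp add: cinner_minus_left)

lemma cinner_zero_left [simp]: "cinner 0 (y::'a::complex_inner) = 0"
  using cinner_diff_left[of 0 0 y] by simp

lemma cinner_diff_right: "cinner x (y - z) = cinner x y - cinner x (z::'a::complex_inner)"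
  using cinner_commute[of x "y - z"] cinner_commute[of y x] cinner_commute[of z x]
  by (simp add: cinner_diff_left)

text \<open>The class postulates homogeneity of the norm for real scalars only; the complex case is
  read off from \<open>cinner_self\<close>, since \<open>a\<close> leaves both arguments of the
  inner product as \<open>a * cnj a\<close>.\<close>

lemma norm_scaleC: "norm (a *\<^sub>C x) = cmod a * norm (x::'a::complex_inner)"
proof -
  have "complex_of_real ((norm (a *\<^sub>C x))\<^sup>2) = cinner (a *\<^sub>C x) (a *\<^sub>C x)"
    by (rule cinner_self[symmetric])
  also have "\<dots> = (a * cnj a) * cinner x x"
    by (simp add: cinner_scaleC_left cinner_scaleC_right)
  also have "\<dots> = complex_of_real ((cmod a * norm x)\<^sup>2)"
    unfolding complex_norm_square[symmetric] cinner_self by (simp add: power_mult_distrib)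
  finally have "complex_of_real ((norm (a *\<^sub>C x))\<^sup>2) = complex_of_real ((cmod a * norm x)\<^sup>2)" .
  then have "(norm (a *\<^sub>C x))\<^sup>2 = (cmod a * norm x)\<^sup>2"
    using of_real_eq_iff by blast
  then show ?thesis
    by (simp add: power2_eq_iff_nonneg)
qed

text \<open>Cauchy-Schwarz for a unit second vector: what remains of \<open>x\<close> after removing
  its projection onto \<open>y\<close> has squared norm
  \<open>(norm x)^2 - (cmod (cinner x y))^2\<close>, which cannot be negative.\<close>

lemma cmod_cinner_le_unit:
  assumes "norm (y::'a::complex_inner) = 1"
  shows "cmod (cinner x y) \<le> norm x"
proof -
  let ?c = "cinner x y"
  have "cinner y x = cnj ?c" "cinner y y = 1"
    using cinner_commute[of y x] cinner_self[of y] assms by simp_all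
  then have "cinner (x - ?c *\<^sub>C y) (x - ?c *\<^sub>C y) = cinner x x - ?c * cnj ?c"
    by (simp add: cinner_diff_left cinner_diff_right cinner_scaleC_left cinner_scaleC_right)
  then have "complex_of_real ((norm (x - ?c *\<^sub>C y))\<^sup>2) = complex_of_real ((norm x)\<^sup>2 - (cmod ?c)\<^sup>2)"
    unfolding cinner_self complex_norm_square[symmetric] of_real_diff .
  then have "(norm (x - ?c *\<^sub>C y))\<^sup>2 = (norm x)\<^sup>2 - (cmod ?c)\<^sup>2"
    using of_real_eq_iff by blast
  then have "(cmod ?c)\<^sup>2 \<le> (norm x)\<^sup>2"
    by (metis diff_ge_0_iff_ge zero_le_power2)
  then show ?thesis
    by (rule power2_le_imp_le) simp
qed

lemma bounded_clinear_scaleC: "bounded_clinear (\<lambda>x::'a::complex_inner. c *\<^sub>C x)"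
  unfolding bounded_clinear_def
  by (auto simp: scaleC_add_right scaleR_scaleC scaleC_scaleC norm_scaleC mult.commute
      intro!: bounded_linear_intro[where K = "cmod c"])

lemma bounded_clinear_zero: "bounded_clinear (\<lambda>x::'a::complex_inner. 0::'b::complex_inner)"
  by (simp add: bounded_clinear_def)

section \<open>Operators\<close>

lemma linear_operatorD:
  assumes "linear_operator T"
  shows "0 \<in> op_dom T"
    and "x \<in> op_dom T \<Longrightarrow> c *\<^sub>C x \<in> op_dom T"
    and "x \<in> op_dom T \<Longrightarrow> y \<in> op_dom T \<Longrightarrow> x + y \<in> op_dom T"
    and "x \<in> op_dom T \<Longrightarrow> y \<in> op_dom T \<Longrightarrow> x - y \<in> op_dom T"
    and "x \<in> op_dom T \<Longrightarrow> - x \<in> op_dom T"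
    and "x \<in> op_dom T \<Longrightarrow> op_app T (c *\<^sub>C x) = c *\<^sub>C op_app T x"
    and "x \<in> op_dom T \<Longrightarrow> y \<in> op_dom T \<Longrightarrow> op_app T (x + y) = op_app T x + op_app T y"
    and "x \<in> op_dom T \<Longrightarrow> y \<in> op_dom T \<Longrightarrow> op_app T (x - y) = op_app T x - op_app T y"
    and "x \<in> op_dom T \<Longrightarrow> op_app T (- x) = - op_app T x"
    and "op_app T 0 = 0"
proof -
  have sub: "complex_vector.subspace (op_dom T)"
    and add: "\<And>x y. x \<in> op_dom T \<Longrightarrow> y \<in> op_dom T \<Longrightarrow> op_app T (x + y) = op_app T x + op_app T y"
    and scale: "\<And>c x. x \<in> op_dom T \<Longrightarrow> op_app T (c *\<^sub>C x) = c *\<^sub>C op_app T x"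
    using assms unfolding linear_operator_def by auto
  show "0 \<in> op_dom T"
    using sub by (rule complex_vector.subspace_0)
  show "x \<in> op_dom T \<Longrightarrow> c *\<^sub>C x \<in> op_dom T"
    using sub by (rule complex_vector.subspace_scale)
  show "x \<in> op_dom T \<Longrightarrow> y \<in> op_dom T \<Longrightarrow> x + y \<in> op_dom T"
    using sub by (rule complex_vector.subspace_add)
  show diff: "x \<in> op_dom T \<Longrightarrow> y \<in> op_dom T \<Longrightarrow> x - y \<in> op_dom T" for x y
    using sub by (rule complex_vector.subspace_diff)
  show neg: "x \<in> op_dom T \<Longrightarrow> - x \<in> op_dom T" for x
    using sub by (rule complex_vector.subspace_neg)
  show "x \<in> op_dom T \<Longrightarrow> op_app T (c *\<^sub>C x) = c *\<^sub>C op_app T x"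
    by (rule scale)
  show "x \<in> op_dom T \<Longrightarrow> y \<in> op_dom T \<Longrightarrow> op_app T (x + y) = op_app T x + op_app T y"
    by (rule add)
  show minus: "x \<in> op_dom T \<Longrightarrow> op_app T (- x) = - op_app T x" for x
    using scale[of x "-1"] by simp
  show "x \<in> op_dom T \<Longrightarrow> y \<in> op_dom T \<Longrightarrow> op_app T (x - y) = op_app T x - op_app T y"
    using add[of x "- y"] neg minus by simp
  show "op_app T 0 = 0"
    using scale[OF complex_vector.subspace_0[OF sub], of 0] by simp
qed

section \<open>Bounded inverses and relative boundedness\<close>

lemma boundedly_invertible_op_inv:
  assumes "boundedly_invertible T"
  shows "op_inv T y \<in> op_dom T" and "op_app T (op_inv T y) = y"
    and "x \<in> op_dom T \<Longrightarrow> op_inv T (op_app T x) = x"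
  using assms unfolding boundedly_invertible_def op_inv_def bij_betw_def
  by (auto simp: inv_into_into f_inv_into_f)

lemma boundedly_invertible_norm_op_inv:
  assumes "boundedly_invertible T"
  obtains K where "K \<ge> 0" "\<And>y. norm (op_inv T y) \<le> K * norm y"
proof -
  obtain K where K: "\<And>y. norm (op_inv T y) \<le> K * norm y"
    using assms unfolding boundedly_invertible_def by blast
  have "norm (op_inv T y) \<le> \<bar>K\<bar> * norm y" for y
    by (rule order.trans[OF K mult_right_mono]) simp_all
  then show ?thesis
    using that[of "\<bar>K\<bar>"] by simp
qed

text \<open>The product of \<open>S\<close> and the inverse of \<open>T\<close> is everywhere
  defined and bounded: apply the relative bound at \<open>op_inv T y\<close>, where \<open>T\<close>
  returns \<open>y\<close>, and estimate the remaining norm by the bound of the inverse.\<close>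

lemma relatively_bounded_op_inv:
  assumes "S bounded_relative_to T" "boundedly_invertible T"
  obtains K where "K \<ge> 0" "\<And>y. op_inv T y \<in> op_dom S"
    "\<And>y. norm (op_app S (op_inv T y)) \<le> K * norm y"
proof -
  obtain a b where ab: "a \<ge> 0" "b \<ge> 0"
      "\<And>x. x \<in> op_dom T \<Longrightarrow> norm (op_app S x) \<le> a * norm x + b * norm (op_app T x)"
    and sub: "op_dom T \<subseteq> op_dom S"
    using assms(1) unfolding relatively_bounded_def by blast
  obtain K where K: "K \<ge> 0" "\<And>y. norm (op_inv T y) \<le> K * norm y"
    using boundedly_invertible_norm_op_inv[OF assms(2)] by blast
  have "norm (op_app S (op_inv T y)) \<le> (a * K + b) * norm y" for y
    using ab(3)[of "op_inv T y"] mult_left_mono[OF K(2)[of y] ab(1)]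
      boundedly_invertible_op_inv[OF assms(2)]
    by (simp add: algebra_simps)
  then show ?thesis
    using ab(1,2) K(1) sub boundedly_invertible_op_inv(1)[OF assms(2)]
    by (intro that[of "a * K + b"]) auto
qed

section \<open>Resolvent set, approximate point spectrum and pseudo numerical range of a
  family\<close>

lemma mem_fam_resolvent_set_iff:
  "z \<in> fam_resolvent_set \<Omega> T \<longleftrightarrow> z \<in> \<Omega> \<and> boundedly_invertible (T z)"
  unfolding fam_resolvent_set_def fam_spectrum_def op_spectrum_def
  by (auto simp: boundedly_invertible_def op_inv_def)

text \<open>If no constant bounds \<open>T z\<close> from below, each constant \<open>n + 1\<close>
  is violated by some vector; normalised, these vectors form an approximate null sequence.\<close>

lemma not_approx_point_spectrum_bounded_below:
  fixes T :: "complex \<Rightarrow> ('a::complex_inner, 'a) operator"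
  assumes "z \<in> \<Omega>" "linear_operator (T z)" "z \<notin> approx_point_spectrum \<Omega> T"
  obtains K where "K \<ge> 0" "\<And>x. x \<in> op_dom (T z) \<Longrightarrow> norm x \<le> K * norm (op_app (T z) x)"
proof -
  have "\<exists>K\<ge>0. \<forall>x\<in>op_dom (T z). norm x \<le> K * norm (op_app (T z) x)"
  proof (rule ccontr)
    assume neg: "\<not> ?thesis"
    have "\<exists>x. x \<in> op_dom (T z) \<and> norm x = 1 \<and>
        norm (op_app (T z) x) \<le> 1 / real (Suc n)" for n
    proof -
      have "real (Suc n) \<ge> 0"
        by simp
      then obtain x where x: "x \<in> op_dom (T z)" "norm x > real (Suc n) * norm (op_app (T z) x)"
        using neg not_le by blast
      \<comment> \<open>The violated inequality is strict, so \<open>x\<close> is nonzero and can be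
        normalised.\<close>
      then have pos: "norm x > 0"
        by (meson le_less_trans mult_nonneg_nonneg norm_ge_zero of_nat_0_le_iff)
      let ?c = "complex_of_real (1 / norm x)"
      have "norm (?c *\<^sub>C x) = 1"
        using pos by (simp add: norm_scaleC norm_divide)
      moreover have "norm (op_app (T z) (?c *\<^sub>C x)) \<le> 1 / real (Suc n)"
        using x pos
        by (simp add: linear_operatorD(6)[OF assms(2)] norm_scaleC norm_divide field_simps
            del: of_nat_Suc)
      ultimately show ?thesis
        using linear_operatorD(2)[OF assms(2) x(1)] by blast
    qed
    then obtain f where f: "\<And>n. f n \<in> op_dom (T z)" "\<And>n. norm (f n) = 1"
        "\<And>n. norm (op_app (T z) (f n)) \<le> 1 / real (Suc n)"
      by metis
    have "(\<lambda>n. op_app (T z) (f n)) \<longlonglongrightarrow> 0"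
      by (rule Lim_null_comparison[OF _ LIMSEQ_inverse_real_of_nat])
        (use f(3) in \<open>simp add: inverse_eq_divide\<close>)
    then show False
      using assms(1,3) f(1,2) unfolding approx_point_spectrum_def by blast
  qed
  then show ?thesis
    using that by blast
qed

lemma approx_point_spectrum_subset_pseudo_numerical_range:
  "approx_point_spectrum \<Omega> T \<subseteq> pseudo_numerical_range \<Omega> T"
proof
  fix z assume "z \<in> approx_point_spectrum \<Omega> T"
  then obtain f where z: "z \<in> \<Omega>" and f: "\<And>n. f n \<in> op_dom (T z)" "\<And>n. norm (f n) = 1"
    "(\<lambda>n. op_app (T z) (f n)) \<longlonglongrightarrow> 0"
    unfolding approx_point_spectrum_def by blast
  show "z \<in> pseudo_numerical_range \<Omega> T"
    unfolding pseudo_numerical_range_def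
  proof
    fix \<epsilon> :: real assume "\<epsilon> \<in> {0<..}"
    then obtain n where n: "norm (op_app (T z) (f n)) < \<epsilon>"
      using f(3) by (metis LIMSEQ_iff diff_zero greaterThan_iff order_refl)
    \<comment> \<open>As \<open>f n\<close> is a unit vector, adding the multiple
      \<open>- ?c\<close> of the identity shifts the quadratic form at \<open>f n\<close> from
      \<open>?c\<close> to zero. By Cauchy-Schwarz its norm is at most that of
      \<open>op_app (T z) (f n)\<close>.\<close>
    let ?c = "cinner (op_app (T z) (f n)) (f n)"
    let ?B = "\<lambda>x. (- ?c) *\<^sub>C x"
    have "onorm ?B \<le> cmod ?c"
      by (rule onorm_bound) (simp_all add: norm_scaleC del: complex_vector.scale_minus_left)
    then have "onorm ?B < \<epsilon>"
      using cmod_cinner_le_unit[OF f(2)[of n], of "op_app (T z) (f n)"] n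
      by (meson le_less_trans)
    moreover have "z \<in> numerical_range \<Omega> (\<lambda>z. op_plus (T z) ?B)"
      unfolding numerical_range_def
      using z f(1)[of n] f(2)[of n] cinner_self[of "f n"]
      by (auto simp: op_plus_def cinner_diff_left cinner_scaleC_left
          intro!: bexI[of _ "f n"])
    ultimately show "z \<in> (\<Union>B\<in>{B. bounded_clinear B \<and> onorm B < \<epsilon>}.
        numerical_range \<Omega> (\<lambda>z. op_plus (T z) B))"
      using bounded_clinear_scaleC[of "- ?c"] by blast
  qed
qed

section \<open>Schur complements\<close>

definition linear_entries :: "('a::complex_inner, 'b::complex_inner) op_matrix \<Rightarrow> bool"
  where "linear_entries M \<longleftrightarrow> linear_operator (entry_A M) \<and> linear_operator (entry_B M) \<and>
    linear_operator (entry_C M) \<and> linear_operator (entry_D M)"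

text \<open>The same matrix with the two summands of the space exchanged. It turns the second Schur
  complement into a first one, so that only \<open>schur1\<close> has to be studied.\<close>

definition swap_matrix :: "('a, 'b) op_matrix \<Rightarrow> ('b, 'a) op_matrix"
  where "swap_matrix M = Op_Matrix (entry_D M) (entry_C M) (entry_B M) (entry_A M)"

lemma swap_matrix_simps [simp]:
  "entry_A (swap_matrix M) = entry_D M" "entry_B (swap_matrix M) = entry_C M"
  "entry_C (swap_matrix M) = entry_B M" "entry_D (swap_matrix M) = entry_A M"
  "dom1 (swap_matrix M) = dom2 M" "dom2 (swap_matrix M) = dom1 M"
  by (auto simp: swap_matrix_def dom1_def dom2_def)

lemma linear_entries_swap [simp]: "linear_entries (swap_matrix M) \<longleftrightarrow> linear_entries M"
  by (auto simp: linear_entries_def)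

lemma schur2_eq_schur1_swap: "schur2 M = schur1 (swap_matrix M)"
  by (simp add: schur1_def schur2_def)

text \<open>Injectivity of \<open>D\<close> identifies \<open>w\<close> with the inverse of
  \<open>D\<close> applied to \<open>C f\<close>. Together with \<open>schur1_domE\<close> this
  allows work with a solution \<open>w\<close> of \<open>D w = C f\<close> in place of
  \<open>op_inv\<close>.\<close>

lemma schur1_eqI:
  assumes "boundedly_invertible (entry_D M)" "f \<in> dom1 M" "w \<in> dom2 M"
    "op_app (entry_D M) w = op_app (entry_C M) f"
  shows "f \<in> op_dom (schur1 M)"
    and "op_app (schur1 M) f = op_app (entry_A M) f - op_app (entry_B M) w"
proof -
  have "op_inv (entry_D M) (op_app (entry_C M) f) = w"
    using assms boundedly_invertible_op_inv(3)[OF assms(1), of w] by (simp add: dom2_def)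
  then show "f \<in> op_dom (schur1 M)"
    and "op_app (schur1 M) f = op_app (entry_A M) f - op_app (entry_B M) w"
    using assms by (auto simp: schur1_def dom2_def)
qed

lemma schur1_domE:
  assumes "boundedly_invertible (entry_D M)" "f \<in> op_dom (schur1 M)"
  obtains w where "f \<in> dom1 M" "w \<in> dom2 M"
    "op_app (entry_D M) w = op_app (entry_C M) f"
    "op_app (schur1 M) f = op_app (entry_A M) f - op_app (entry_B M) w"
  using that[of "op_inv (entry_D M) (op_app (entry_C M) f)"]
    assms(2) boundedly_invertible_op_inv[OF assms(1)]
  by (simp add: schur1_def dom2_def)

text \<open>Solutions of \<open>D w = C f\<close> add and scale along with \<open>f\<close>, and so
  the sum and the multiple of given solutions serve as witnesses.\<close>

lemma linear_operator_schur1: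
  assumes lin: "linear_entries M" and inv: "boundedly_invertible (entry_D M)"
  shows "linear_operator (schur1 M)"
proof -
  let ?S = "schur1 M"
  have LA: "linear_operator (entry_A M)" and LB: "linear_operator (entry_B M)"
    and LC: "linear_operator (entry_C M)" and LD: "linear_operator (entry_D M)"
    using lin by (auto simp: linear_entries_def)
  note L = linear_operatorD[OF LA] linear_operatorD[OF LB]
    linear_operatorD[OF LC] linear_operatorD[OF LD]
  have zero: "0 \<in> op_dom ?S"
    by (rule schur1_eqI(1)[OF inv, of _ 0]) (simp_all add: dom1_def dom2_def L)
  have add: "x + y \<in> op_dom ?S \<and> op_app ?S (x + y) = op_app ?S x + op_app ?S y"
    if x: "x \<in> op_dom ?S" and y: "y \<in> op_dom ?S" for x y
  proof -
    obtain v where v: "x \<in> dom1 M" "v \<in> dom2 M" "op_app (entry_D M) v = op_app (entry_C M) x"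
      "op_app ?S x = op_app (entry_A M) x - op_app (entry_B M) v"
      using schur1_domE[OF inv x] by blast
    obtain w where w: "y \<in> dom1 M" "w \<in> dom2 M" "op_app (entry_D M) w = op_app (entry_C M) y"
      "op_app ?S y = op_app (entry_A M) y - op_app (entry_B M) w"
      using schur1_domE[OF inv y] by blast
    have "x + y \<in> dom1 M" "v + w \<in> dom2 M"
      "op_app (entry_D M) (v + w) = op_app (entry_C M) (x + y)"
      using v w by (auto simp: dom1_def dom2_def L)
    from schur1_eqI[OF inv this] show ?thesis
      using v w by (simp add: dom1_def dom2_def L)
  qed
  have scale: "c *\<^sub>C x \<in> op_dom ?S \<and> op_app ?S (c *\<^sub>C x) = c *\<^sub>C op_app ?S x"
    if x: "x \<in> op_dom ?S" for c x
  proof -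
    obtain v where v: "x \<in> dom1 M" "v \<in> dom2 M" "op_app (entry_D M) v = op_app (entry_C M) x"
      "op_app ?S x = op_app (entry_A M) x - op_app (entry_B M) v"
      using schur1_domE[OF inv x] by blast
    have "c *\<^sub>C x \<in> dom1 M" "c *\<^sub>C v \<in> dom2 M"
      "op_app (entry_D M) (c *\<^sub>C v) = op_app (entry_C M) (c *\<^sub>C x)"
      using v by (auto simp: dom1_def dom2_def L)
    from schur1_eqI[OF inv this] show ?thesis
      using v by (simp add: dom1_def dom2_def L complex_vector.scale_right_diff_distrib)
  qed
  show ?thesis
    unfolding linear_operator_def complex_vector.subspace_def
    using zero add scale by auto
qed

section \<open>Controlling vectors by the matrix through a Schur complement\<close>

text \<open>An arbitrary pair \<open>f\<close>, \<open>g\<close> is compared with one vector of the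
  domain of \<open>schur1\<close>, the errors being measured by the two components of the image
  under the matrix. The disjuncts of \<open>cond\<close> are the parts of (i) and (ii) that concern
  the first Schur complement.\<close>

lemma schur1_approximation:
  assumes lin: "linear_entries M" and inv: "boundedly_invertible (entry_D M)"
    and cond: "entry_B M bounded_relative_to entry_D M \<or>
      entry_A M bounded_relative_to entry_C M \<and> boundedly_invertible (entry_C M)"
  obtains K where "K \<ge> 0"
    "\<And>f g. f \<in> dom1 M \<Longrightarrow> g \<in> dom2 M \<Longrightarrow> \<exists>f'\<in>op_dom (schur1 M).
      norm (f - f') \<le> K * norm (op_app (entry_C M) f + op_app (entry_D M) g) \<and>
      norm (op_app (schur1 M) f') \<le> norm (op_app (entry_A M) f + op_app (entry_B M) g) +
        K * norm (op_app (entry_C M) f + op_app (entry_D M) g)"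
proof -
  have LA: "linear_operator (entry_A M)" and LB: "linear_operator (entry_B M)"
    and LC: "linear_operator (entry_C M)" and LD: "linear_operator (entry_D M)"
    using lin by (auto simp: linear_entries_def)
  note L = linear_operatorD[OF LA] linear_operatorD[OF LB]
    linear_operatorD[OF LC] linear_operatorD[OF LD]
  from cond show ?thesis
  proof
    assume "entry_B M bounded_relative_to entry_D M"
    then obtain K where K: "K \<ge> 0" "\<And>y. op_inv (entry_D M) y \<in> op_dom (entry_B M)"
      "\<And>y. norm (op_app (entry_B M) (op_inv (entry_D M) y)) \<le> K * norm y"
      using relatively_bounded_op_inv[OF _ inv] by metis
    show ?thesis
    proof (rule that[OF K(1)])
      fix f g assume fg: "f \<in> dom1 M" "g \<in> dom2 M"
      let ?u = "op_app (entry_A M) f + op_app (entry_B M) g"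
      let ?v = "op_app (entry_C M) f + op_app (entry_D M) g"
      \<comment> \<open>Since \<open>?v = C f + D g\<close>, this vector solves
        \<open>D w = C f\<close>. Relative boundedness puts it into the domain of \<open>B\<close>,
        and \<open>f\<close> itself can serve as \<open>f'\<close>.\<close>
      let ?w = "op_inv (entry_D M) ?v - g"
      have "?w \<in> dom2 M" "op_app (entry_D M) ?w = op_app (entry_C M) f"
        using fg K(2) boundedly_invertible_op_inv[OF inv] by (auto simp: dom2_def L)
      note S = schur1_eqI[OF inv fg(1) this]
      have "op_app (schur1 M) f = ?u - op_app (entry_B M) (op_inv (entry_D M) ?v)"
        using S(2) fg K(2) by (simp add: dom2_def L)
      then have "norm (op_app (schur1 M) f) \<le> norm ?u + K * norm ?v"
        using norm_triangle_ineq4[of ?u "op_app (entry_B M) (op_inv (entry_D M) ?v)"] K(3)[of ?v]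
        by simp
      then show "\<exists>f'\<in>op_dom (schur1 M). norm (f - f') \<le> K * norm ?v \<and>
          norm (op_app (schur1 M) f') \<le> norm ?u + K * norm ?v"
        using S(1) K(1) by (intro bexI[of _ f]) simp_all
    qed
  next
    assume asm: "entry_A M bounded_relative_to entry_C M \<and> boundedly_invertible (entry_C M)"
    then have invC: "boundedly_invertible (entry_C M)"
      by simp
    obtain K where K: "K \<ge> 0" "\<And>y. op_inv (entry_C M) y \<in> op_dom (entry_A M)"
      "\<And>y. norm (op_app (entry_A M) (op_inv (entry_C M) y)) \<le> K * norm y"
      using relatively_bounded_op_inv asm by metis
    obtain K' where K': "K' \<ge> 0" "\<And>y. norm (op_inv (entry_C M) y) \<le> K' * norm y"
      using boundedly_invertible_norm_op_inv[OF invC] by blast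
    show ?thesis
    \<comment> \<open>\<open>K'\<close> bounds the shift from \<open>f\<close> to \<open>f'\<close>,
      and \<open>K\<close> bounds \<open>A\<close> composed with the inverse of \<open>C\<close>;
      their sum covers both estimates.\<close>
    proof (rule that[of "K + K'"])
      show "0 \<le> K + K'"
        using K K' by simp
      fix f g assume fg: "f \<in> dom1 M" "g \<in> dom2 M"
      let ?u = "op_app (entry_A M) f + op_app (entry_B M) g"
      let ?v = "op_app (entry_C M) f + op_app (entry_D M) g"
      \<comment> \<open>The correction is chosen so that \<open>C ?f = C f - ?v = D (- g)\<close>;
        hence \<open>- g\<close> is the solution that \<open>schur1_eqI\<close> asks for.\<close>
      let ?f = "f - op_inv (entry_C M) ?v"
      have "?f \<in> dom1 M" "- g \<in> dom2 M" "op_app (entry_D M) (- g) = op_app (entry_C M) ?f"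
        using fg K(2) boundedly_invertible_op_inv[OF invC] by (auto simp: dom1_def dom2_def L)
      note S = schur1_eqI[OF inv this]
      have "op_app (schur1 M) ?f = ?u - op_app (entry_A M) (op_inv (entry_C M) ?v)"
        using S(2) fg K(2) by (simp add: dom1_def dom2_def L)
      then have "norm (op_app (schur1 M) ?f) \<le> norm ?u + K * norm ?v"
        using norm_triangle_ineq4[of ?u "op_app (entry_A M) (op_inv (entry_C M) ?v)"] K(3)[of ?v]
        by simp
      then show "\<exists>f'\<in>op_dom (schur1 M). norm (f - f') \<le> (K + K') * norm ?v \<and>
          norm (op_app (schur1 M) f') \<le> norm ?u + (K + K') * norm ?v"
        using S(1) K'(2)[of ?v] mult_nonneg_nonneg[OF K(1) norm_ge_zero[of ?v]]
          mult_nonneg_nonneg[OF K'(1) norm_ge_zero[of ?v]]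
        by (intro bexI[of _ ?f]) (simp_all add: distrib_right)
    qed
  qed
qed

text \<open>The triangle inequality through the approximating vector \<open>f'\<close>: its distance
  to \<open>f\<close> is already controlled, and its norm is controlled by the lower bound for
  \<open>schur1\<close>. Only the first component is estimated; the second is left to the other
  Schur complement.\<close>

lemma schur1_bounded_below_imp_norm_le:
  assumes "linear_entries M" "boundedly_invertible (entry_D M)"
    and "entry_B M bounded_relative_to entry_D M \<or>
      entry_A M bounded_relative_to entry_C M \<and> boundedly_invertible (entry_C M)"
    and c: "c \<ge> 0" "\<And>x. x \<in> op_dom (schur1 M) \<Longrightarrow> norm x \<le> c * norm (op_app (schur1 M) x)"
  obtains K where "\<And>f g. f \<in> dom1 M \<Longrightarrow> g \<in> dom2 M \<Longrightarrow>
    norm f \<le> K * (norm (op_app (entry_A M) f + op_app (entry_B M) g) +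
      norm (op_app (entry_C M) f + op_app (entry_D M) g))"
proof -
  obtain K where K: "K \<ge> 0"
    "\<And>f g. f \<in> dom1 M \<Longrightarrow> g \<in> dom2 M \<Longrightarrow> \<exists>f'\<in>op_dom (schur1 M).
      norm (f - f') \<le> K * norm (op_app (entry_C M) f + op_app (entry_D M) g) \<and>
      norm (op_app (schur1 M) f') \<le> norm (op_app (entry_A M) f + op_app (entry_B M) g) +
        K * norm (op_app (entry_C M) f + op_app (entry_D M) g)"
    using schur1_approximation[OF assms(1-3)] by blast
  show ?thesis
  proof (rule that[of "K + c + c * K"])
    fix f g assume "f \<in> dom1 M" "g \<in> dom2 M"
    define u v where "u = norm (op_app (entry_A M) f + op_app (entry_B M) g)"
      and "v = norm (op_app (entry_C M) f + op_app (entry_D M) g)"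
    obtain f' where f': "f' \<in> op_dom (schur1 M)" "norm (f - f') \<le> K * v"
      "norm (op_app (schur1 M) f') \<le> u + K * v"
      using K(2)[OF \<open>f \<in> dom1 M\<close> \<open>g \<in> dom2 M\<close>] unfolding u_def v_def by blast
    have "norm f \<le> norm (f - f') + norm f'"
      using norm_triangle_ineq[of "f - f'" f'] by simp
    also have "\<dots> \<le> K * v + c * (u + K * v)"
      using f'(2) c(2)[OF f'(1)] mult_left_mono[OF f'(3) c(1)] by linarith
    also have "\<dots> \<le> (K + c + c * K) * (u + v)"
    proof -
      \<comment> \<open>The sum of these three terms is exactly the excess of the right side over
        the left.\<close>
      have "0 \<le> K * u" "0 \<le> c * v" "0 \<le> c * K * u"
        using K(1) c(1) by (simp_all add: u_def v_def)
      then show ?thesis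
        by (simp add: algebra_simps)
    qed
    finally show "norm f \<le> (K + c + c * K) *
        (norm (op_app (entry_A M) f + op_app (entry_B M) g) +
          norm (op_app (entry_C M) f + op_app (entry_D M) g))"
      by (simp add: u_def v_def)
  qed
qed

text \<open>If \<open>z\<close> were in neither set, both Schur complements would be bounded below
  at \<open>z\<close>, and the image under the matrix would control both components of a vector.
  \<open>cond1\<close> serves the first component, \<open>cond2\<close> the second.\<close>

lemma approx_point_spectrum_matrix_subset_schur:
  fixes L :: "complex \<Rightarrow> ('a::complex_inner, 'b::complex_inner) op_matrix"
  assumes z: "z \<in> approx_point_spectrum \<Omega> (\<lambda>z. matrix_operator (L z))"
    and lin: "linear_entries (L z)"
    and invA: "boundedly_invertible (entry_A (L z))"
    and invD: "boundedly_invertible (entry_D (L z))"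
    and \<rho>: "z \<in> \<rho>A" "z \<in> \<rho>D"
    and cond1: "entry_B (L z) bounded_relative_to entry_D (L z) \<or>
      entry_A (L z) bounded_relative_to entry_C (L z) \<and> boundedly_invertible (entry_C (L z))"
    and cond2: "entry_C (L z) bounded_relative_to entry_A (L z) \<or>
      entry_D (L z) bounded_relative_to entry_B (L z) \<and> boundedly_invertible (entry_B (L z))"
  shows "z \<in> approx_point_spectrum \<rho>D (\<lambda>z. schur1 (L z)) \<union>
    approx_point_spectrum \<rho>A (\<lambda>z. schur2 (L z))"
proof (rule ccontr)
  assume neg: "\<not> ?thesis"
  let ?M = "L z"
  have linS: "linear_operator (schur1 ?M)" "linear_operator (schur2 ?M)"
    using linear_operator_schur1[OF lin invD] linear_operator_schur1[of "swap_matrix ?M"] lin invA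
    by (simp_all add: schur2_eq_schur1_swap)
  obtain c1 where c1: "c1 \<ge> 0"
    "\<And>x. x \<in> op_dom (schur1 ?M) \<Longrightarrow> norm x \<le> c1 * norm (op_app (schur1 ?M) x)"
    using not_approx_point_spectrum_bounded_below[of z \<rho>D "\<lambda>z. schur1 (L z)"] \<rho> linS neg by auto
  obtain c2 where c2: "c2 \<ge> 0"
    "\<And>x. x \<in> op_dom (schur2 ?M) \<Longrightarrow> norm x \<le> c2 * norm (op_app (schur2 ?M) x)"
    using not_approx_point_spectrum_bounded_below[of z \<rho>A "\<lambda>z. schur2 (L z)"] \<rho> linS neg by auto
  obtain K1 where K1: "\<And>f g. f \<in> dom1 ?M \<Longrightarrow> g \<in> dom2 ?M \<Longrightarrow>
    norm f \<le> K1 * (norm (op_app (entry_A ?M) f + op_app (entry_B ?M) g) +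
      norm (op_app (entry_C ?M) f + op_app (entry_D ?M) g))"
    using schur1_bounded_below_imp_norm_le[OF lin invD cond1 c1] by blast
  \<comment> \<open>The bound for the second component is the previous lemma for the exchanged
    matrix; afterwards only the order of the summands has to be restored.\<close>
  have sw: "linear_entries (swap_matrix ?M)" "boundedly_invertible (entry_D (swap_matrix ?M))"
    "entry_B (swap_matrix ?M) bounded_relative_to entry_D (swap_matrix ?M) \<or>
      entry_A (swap_matrix ?M) bounded_relative_to entry_C (swap_matrix ?M) \<and>
      boundedly_invertible (entry_C (swap_matrix ?M))"
    using lin invA cond2 by simp_all
  obtain K2 where "\<And>g f. g \<in> dom1 (swap_matrix ?M) \<Longrightarrow> f \<in> dom2 (swap_matrix ?M) \<Longrightarrow>
    norm g \<le> K2 *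
      (norm (op_app (entry_A (swap_matrix ?M)) g + op_app (entry_B (swap_matrix ?M)) f) +
        norm (op_app (entry_C (swap_matrix ?M)) g + op_app (entry_D (swap_matrix ?M)) f))"
    using schur1_bounded_below_imp_norm_le[OF sw c2[unfolded schur2_eq_schur1_swap]] by blast
  then have K2: "norm g \<le> K2 * (norm (op_app (entry_A ?M) f + op_app (entry_B ?M) g) +
      norm (op_app (entry_C ?M) f + op_app (entry_D ?M) g))"
    if "f \<in> dom1 ?M" "g \<in> dom2 ?M" for f g
    using that by (simp add: add.commute)
  obtain h where h: "\<And>n. h n \<in> op_dom (matrix_operator ?M)" "\<And>n. norm (h n) = 1"
    "(\<lambda>n. op_app (matrix_operator ?M) (h n)) \<longlonglongrightarrow> 0"
    using z unfolding approx_point_spectrum_def by blast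
  define f g where "f n = fst (h n)" and "g n = snd (h n)" for n
  define u v where "u n = op_app (entry_A ?M) (f n) + op_app (entry_B ?M) (g n)"
    and "v n = op_app (entry_C ?M) (f n) + op_app (entry_D ?M) (g n)" for n
  have fg: "f n \<in> dom1 ?M" "g n \<in> dom2 ?M" for n
    using h(1)[of n] by (auto simp: matrix_operator_def f_def g_def)
  have "(\<lambda>n. (u n, v n)) \<longlonglongrightarrow> 0"
    using h(3) by (simp add: matrix_operator_def u_def v_def f_def g_def case_prod_beta)
  then have "u \<longlonglongrightarrow> 0" "v \<longlonglongrightarrow> 0"
    using tendsto_fst[of "\<lambda>n. (u n, v n)"] tendsto_snd[of "\<lambda>n. (u n, v n)"]
    by (fastforce simp: zero_prod_def)+
  then have uv: "(\<lambda>n. norm (u n) + norm (v n)) \<longlonglongrightarrow> 0"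
    by (intro tendsto_add_zero tendsto_norm_zero)
  \<comment> \<open>This null sequence dominates \<open>norm (f n) + norm (g n)\<close>, which is at
    least the norm 1 of \<open>h n\<close>.\<close>
  have "(\<lambda>n. K1 * (norm (u n) + norm (v n)) + K2 * (norm (u n) + norm (v n))) \<longlonglongrightarrow> 0"
    by (intro tendsto_add_zero tendsto_mult_right_zero uv)
  moreover have "1 \<le> K1 * (norm (u n) + norm (v n)) + K2 * (norm (u n) + norm (v n))" for n
  proof -
    have "1 \<le> norm (f n) + norm (g n)"
      using norm_Pair_le[of "f n" "g n"] h(2)[of n] by (simp add: f_def g_def)
    then show ?thesis
      using K1[OF fg[of n]] K2[OF fg[of n]] unfolding u_def v_def by linarith
  qed
  ultimately show False
    by (meson LIMSEQ_le_const not_one_le_zero)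
qed

section \<open>Quadratic numerical ranges\<close>

text \<open>The off-diagonal entries are perturbed only by \<open>B\<^sub>1 0\<close> and
  \<open>B\<^sub>2 0\<close>, which vanish, and a zero determinant of size two is an equality of two
  products.\<close>

lemma mem_quadratic_numerical_range_diag_iff:
  assumes "bounded_clinear B\<^sub>1" "bounded_clinear B\<^sub>2"
  shows "z \<in> quadratic_numerical_range \<Omega> (\<lambda>z. matrix_plus (L z) (map_prod B\<^sub>1 B\<^sub>2)) \<longleftrightarrow>
    z \<in> \<Omega> \<and> (\<exists>f\<in>dom1 (L z). \<exists>g\<in>dom2 (L z). norm f = 1 \<and> norm g = 1 \<and>
      cinner (op_app (entry_A (L z)) f + B\<^sub>1 f) f * cinner (op_app (entry_D (L z)) g + B\<^sub>2 g) g =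
      cinner (op_app (entry_B (L z)) g) f * cinner (op_app (entry_C (L z)) f) g)"
proof -
  have "B\<^sub>1 0 = 0" "B\<^sub>2 0 = 0"
    using assms by (auto simp: bounded_clinear_def linear_simps)
  then show ?thesis
    by (simp add: quadratic_numerical_range_def det_2 matrix_plus_def op_plus_def dom1_def
        dom2_def)
qed

text \<open>Here \<open>B\<close> is the perturbation, not the entry. A nonzero \<open>g\<close> is
  found first; unit vectors come last, because both products scale by the same factor.\<close>

lemma schur1_numerical_range_quadratic:
  assumes lin: "linear_entries M" and inv: "boundedly_invertible (entry_D M)"
    and f: "f \<in> op_dom (schur1 M)" "f \<noteq> 0" "cinner (op_app (schur1 M) f + B f) f = 0"
    and B: "bounded_clinear B"
    and dom2: "\<exists>g\<in>dom2 M. g \<noteq> 0"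
  shows "\<exists>f\<in>dom1 M. \<exists>g\<in>dom2 M. norm f = 1 \<and> norm g = 1 \<and>
    cinner (op_app (entry_A M) f + B f) f * cinner (op_app (entry_D M) g) g =
    cinner (op_app (entry_B M) g) f * cinner (op_app (entry_C M) f) g"
proof -
  have LA: "linear_operator (entry_A M)" and LB: "linear_operator (entry_B M)"
    and LC: "linear_operator (entry_C M)" and LD: "linear_operator (entry_D M)"
    using lin by (auto simp: linear_entries_def)
  note L = linear_operatorD[OF LA] linear_operatorD[OF LB]
    linear_operatorD[OF LC] linear_operatorD[OF LD]
  have Bs: "B (c *\<^sub>C x) = c *\<^sub>C B x" for c x
    using B by (simp add: bounded_clinear_def)
  obtain w where w: "f \<in> dom1 M" "w \<in> dom2 M"
    "op_app (entry_D M) w = op_app (entry_C M) f"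
    "op_app (schur1 M) f = op_app (entry_A M) f - op_app (entry_B M) w"
    using schur1_domE[OF inv f(1)] by blast
  have "\<exists>g\<in>dom2 M. g \<noteq> 0 \<and>
    cinner (op_app (entry_A M) f + B f) f * cinner (op_app (entry_D M) g) g =
    cinner (op_app (entry_B M) g) f * cinner (op_app (entry_C M) f) g"
  proof (cases "w = 0")
    \<comment> \<open>Now \<open>schur1\<close> acts on \<open>f\<close> as \<open>A\<close> does,
      and \<open>C f = D 0 = 0\<close>. Both products vanish for every \<open>g\<close>, and
      \<open>dom2\<close> provides a nonzero one.\<close>
    case True
    then show ?thesis
      using w f(3) dom2 by (auto simp: L)
  next
    case False
    \<comment> \<open>This equates the first entries of the two columns at \<open>f\<close>,
      \<open>w\<close>; the second entries agree by \<open>D w = C f\<close>.\<close>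
    have "cinner (op_app (entry_A M) f + B f) f = cinner (op_app (entry_B M) w) f"
      using f(3) w(4) by (simp add: cinner_add_left cinner_diff_left algebra_simps)
    then show ?thesis
      using w False by (intro bexI[of _ w]) auto
  qed
  then obtain g where g: "g \<in> dom2 M" "g \<noteq> 0"
    "cinner (op_app (entry_A M) f + B f) f * cinner (op_app (entry_D M) g) g =
      cinner (op_app (entry_B M) g) f * cinner (op_app (entry_C M) f) g"
    by blast
  define a b where "a = complex_of_real (1 / norm f)" and "b = complex_of_real (1 / norm g)"
  have real: "cnj a = a" "cnj b = b"
    by (simp_all add: a_def b_def)
  have "op_app (entry_A M) (a *\<^sub>C f) + B (a *\<^sub>C f) = a *\<^sub>C (op_app (entry_A M) f + B f)"
    "op_app (entry_D M) (b *\<^sub>C g) = b *\<^sub>C op_app (entry_D M) g"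
    "op_app (entry_B M) (b *\<^sub>C g) = b *\<^sub>C op_app (entry_B M) g"
    "op_app (entry_C M) (a *\<^sub>C f) = a *\<^sub>C op_app (entry_C M) f"
    using w(1) g(1) by (auto simp: dom1_def dom2_def L Bs scaleC_add_right)
  then have "cinner (op_app (entry_A M) (a *\<^sub>C f) + B (a *\<^sub>C f)) (a *\<^sub>C f) *
      cinner (op_app (entry_D M) (b *\<^sub>C g)) (b *\<^sub>C g) =
    cinner (op_app (entry_B M) (b *\<^sub>C g)) (a *\<^sub>C f) *
      cinner (op_app (entry_C M) (a *\<^sub>C f)) (b *\<^sub>C g)"
    using g(3) by (simp add: cinner_scaleC_left cinner_scaleC_right real)
  moreover have "norm (a *\<^sub>C f) = 1" "norm (b *\<^sub>C g) = 1"
    using f(2) g(2) by (simp_all add: norm_scaleC a_def b_def norm_divide)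
  moreover have "a *\<^sub>C f \<in> dom1 M" "b *\<^sub>C g \<in> dom2 M"
    using w(1) g(1) by (auto simp: dom1_def dom2_def L)
  ultimately show ?thesis
    by blast
qed

lemma pseudo_numerical_rangeE:
  assumes "z \<in> pseudo_numerical_range \<Omega> T" "\<epsilon> > 0"
  obtains B f where "bounded_clinear B" "onorm B < \<epsilon>" "z \<in> \<Omega>" "f \<in> op_dom (T z)" "f \<noteq> 0"
    "cinner (op_app (T z) f + B f) f = 0"
proof -
  have "z \<in> (\<Union>B\<in>{B. bounded_clinear B \<and> onorm B < \<epsilon>}.
      numerical_range \<Omega> (\<lambda>z. op_plus (T z) B))"
    using assms unfolding pseudo_numerical_range_def by blast
  then show ?thesis
    using that unfolding numerical_range_def by (auto simp: op_plus_def)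
qed

text \<open>A set without nonzero elements lies in the closed set \<open>{0}\<close>. This supplies
  the freely chosen vector for the case of a vanishing solution \<open>w\<close>.\<close>

lemma dense_exists_nonzero:
  fixes X :: "'a::real_normed_vector set"
  assumes "closure X = UNIV" "\<exists>x::'a. x \<noteq> 0"
  shows "\<exists>x\<in>X. x \<noteq> 0"
proof (rule ccontr)
  assume "\<not> ?thesis"
  then have "closure X \<subseteq> closure {0}"
    by (intro closure_mono) auto
  then show False
    using assms by auto
qed

text \<open>A perturbation \<open>B\<close> of the first Schur complement becomes
  \<open>diag(B, 0)\<close>, one of the second becomes \<open>diag(0, B)\<close>; the norm bound is
  unchanged.\<close>

lemma pseudo_numerical_range_schur_subset_diag:
  fixes L :: "complex \<Rightarrow> ('a::complex_inner, 'b::complex_inner) op_matrix"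
  assumes nonzero: "\<exists>x::'a. x \<noteq> 0" "\<exists>y::'b. y \<noteq> 0"
    and lin: "\<And>z. z \<in> \<Omega> \<Longrightarrow> linear_entries (L z)"
    and dense: "\<And>z. z \<in> \<Omega> \<Longrightarrow> densely_defined (matrix_operator (L z))"
  shows "pseudo_numerical_range (fam_resolvent_set \<Omega> (\<lambda>z. entry_D (L z))) (\<lambda>z. schur1 (L z)) \<union>
      pseudo_numerical_range (fam_resolvent_set \<Omega> (\<lambda>z. entry_A (L z))) (\<lambda>z. schur2 (L z))
    \<subseteq> diag_pseudo_quadratic_numerical_range \<Omega> L"
proof
  fix z
  assume z: "z \<in> pseudo_numerical_range (fam_resolvent_set \<Omega> (\<lambda>z. entry_D (L z)))
      (\<lambda>z. schur1 (L z)) \<union>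
    pseudo_numerical_range (fam_resolvent_set \<Omega> (\<lambda>z. entry_A (L z))) (\<lambda>z. schur2 (L z))"
  have dom: "\<exists>f\<in>dom1 (L z). f \<noteq> 0" "\<exists>g\<in>dom2 (L z). g \<noteq> 0" if "z \<in> \<Omega>"
  proof -
    \<comment> \<open>Intersections of dense subspaces may fail to be dense, so density of
      \<open>dom1\<close> and \<open>dom2\<close> is taken from the domain of the matrix.\<close>
    have "closure (dom1 (L z)) \<times> closure (dom2 (L z)) = UNIV"
      using dense[OF that] by (simp add: densely_defined_def matrix_operator_def closure_Times)
    then have "closure (dom1 (L z)) = UNIV" "closure (dom2 (L z)) = UNIV"
      by auto
    then show "\<exists>f\<in>dom1 (L z). f \<noteq> 0" "\<exists>g\<in>dom2 (L z). g \<noteq> 0"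
      using dense_exists_nonzero nonzero by blast+
  qed
  show "z \<in> diag_pseudo_quadratic_numerical_range \<Omega> L"
    unfolding diag_pseudo_quadratic_numerical_range_def
  proof
    fix \<epsilon> :: real assume "\<epsilon> \<in> {0<..}"
    then have \<epsilon>: "\<epsilon> > 0"
      by simp
    have zero: "onorm (\<lambda>x::'a. 0::'a) < \<epsilon>" "onorm (\<lambda>x::'b. 0::'b) < \<epsilon>"
      using \<epsilon> by (simp_all add: onorm_zero)
    from z have "\<exists>B\<^sub>1 B\<^sub>2. bounded_clinear B\<^sub>1 \<and> onorm B\<^sub>1 < \<epsilon> \<and> bounded_clinear B\<^sub>2 \<and> onorm B\<^sub>2 < \<epsilon> \<and>
      z \<in> quadratic_numerical_range \<Omega> (\<lambda>z. matrix_plus (L z) (map_prod B\<^sub>1 B\<^sub>2))"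
    proof
      assume "z \<in> pseudo_numerical_range (fam_resolvent_set \<Omega> (\<lambda>z. entry_D (L z)))
        (\<lambda>z. schur1 (L z))"
      then obtain B f where B: "bounded_clinear B" "onorm B < \<epsilon>"
        and z: "z \<in> \<Omega>" "boundedly_invertible (entry_D (L z))"
        and f: "f \<in> op_dom (schur1 (L z))" "f \<noteq> 0" "cinner (op_app (schur1 (L z)) f + B f) f = 0"
        using \<epsilon> by (auto simp: mem_fam_resolvent_set_iff elim: pseudo_numerical_rangeE)
      show ?thesis
        using schur1_numerical_range_quadratic[OF lin[OF z(1)] z(2) f B(1) dom(2)[OF z(1)]]
          B z(1) zero
        by (intro exI[of _ B] exI[of _ "\<lambda>_. 0"])
          (simp add: mem_quadratic_numerical_range_diag_iff bounded_clinear_zero)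
    next
      assume "z \<in> pseudo_numerical_range (fam_resolvent_set \<Omega> (\<lambda>z. entry_A (L z)))
        (\<lambda>z. schur2 (L z))"
      then obtain B g where B: "bounded_clinear B" "onorm B < \<epsilon>"
        and z: "z \<in> \<Omega>" "boundedly_invertible (entry_A (L z))"
        and g: "g \<in> op_dom (schur2 (L z))" "g \<noteq> 0" "cinner (op_app (schur2 (L z)) g + B g) g = 0"
        using \<epsilon> by (auto simp: mem_fam_resolvent_set_iff elim: pseudo_numerical_rangeE)
      \<comment> \<open>The exchanged matrix gives the same determinant condition with the factors
        of both products reversed.\<close>
      have "\<exists>g\<in>dom2 (L z). \<exists>f\<in>dom1 (L z). norm g = 1 \<and> norm f = 1 \<and>
        cinner (op_app (entry_D (L z)) g + B g) g * cinner (op_app (entry_A (L z)) f) f =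
        cinner (op_app (entry_C (L z)) f) g * cinner (op_app (entry_B (L z)) g) f"
        using schur1_numerical_range_quadratic[of "swap_matrix (L z)" g B] lin[OF z(1)] z(2) g
          B(1) dom(1)[OF z(1)]
        by (simp add: schur2_eq_schur1_swap)
      then have "\<exists>f\<in>dom1 (L z). \<exists>g\<in>dom2 (L z). norm f = 1 \<and> norm g = 1 \<and>
        cinner (op_app (entry_A (L z)) f) f * cinner (op_app (entry_D (L z)) g + B g) g =
        cinner (op_app (entry_B (L z)) g) f * cinner (op_app (entry_C (L z)) f) g"
        by (metis mult.commute)
      then show ?thesis
        using B z(1) zero
        by (intro exI[of _ "\<lambda>_. 0"] exI[of _ B])
          (simp add: mem_quadratic_numerical_range_diag_iff bounded_clinear_zero)
    qed
    then show "z \<in> (\<Union>B\<^sub>1\<in>{B. bounded_clinear B \<and> onorm B < \<epsilon>}.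
        \<Union>B\<^sub>2\<in>{B. bounded_clinear B \<and> onorm B < \<epsilon>}.
          quadratic_numerical_range \<Omega> (\<lambda>z. matrix_plus (L z) (map_prod B\<^sub>1 B\<^sub>2)))"
      by blast
  qed
qed

section \<open>Block diagonal perturbations as perturbations of the whole matrix\<close>

lemma bounded_clinear_map_prod:
  assumes "bounded_clinear B\<^sub>1" "bounded_clinear B\<^sub>2"
  shows "bounded_clinear (map_prod B\<^sub>1 B\<^sub>2)"
proof -
  have "bounded_linear (\<lambda>x. (B\<^sub>1 (fst x), B\<^sub>2 (snd x)))"
    using assms unfolding bounded_clinear_def
    by (intro bounded_linear_Pair bounded_linear_compose[OF _ bounded_linear_fst]
        bounded_linear_compose[OF _ bounded_linear_snd]) auto
  moreover have "map_prod B\<^sub>1 B\<^sub>2 = (\<lambda>x. (B\<^sub>1 (fst x), B\<^sub>2 (snd x)))"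
    by auto
  ultimately show ?thesis
    using assms by (simp add: bounded_clinear_def scaleC_prod_def)
qed

text \<open>The squared norm on the product is the sum of the squares, so the blocks do not add up.
  With the maximum as bound, the same \<open>\<epsilon>\<close> can be kept.\<close>

lemma onorm_map_prod_le:
  assumes "bounded_linear B\<^sub>1" "bounded_linear B\<^sub>2"
  shows "onorm (map_prod B\<^sub>1 B\<^sub>2) \<le> max (onorm B\<^sub>1) (onorm B\<^sub>2)"
proof (rule onorm_bound)
  let ?m = "max (onorm B\<^sub>1) (onorm B\<^sub>2)"
  show m: "0 \<le> ?m"
    using onorm_pos_le[OF assms(1)] by (simp add: le_max_iff_disj)
  fix x
  have "norm (B\<^sub>1 (fst x)) \<le> ?m * norm (fst x)" "norm (B\<^sub>2 (snd x)) \<le> ?m * norm (snd x)"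
    using onorm[OF assms(1), of "fst x"] onorm[OF assms(2), of "snd x"]
      mult_right_mono[of "onorm B\<^sub>1" ?m "norm (fst x)"]
      mult_right_mono[of "onorm B\<^sub>2" ?m "norm (snd x)"]
    by auto
  then have "(norm (B\<^sub>1 (fst x)))\<^sup>2 + (norm (B\<^sub>2 (snd x)))\<^sup>2 \<le>
      (?m * norm (fst x))\<^sup>2 + (?m * norm (snd x))\<^sup>2"
    by (intro add_mono power_mono) auto
  also have "\<dots> = ?m\<^sup>2 * ((norm (fst x))\<^sup>2 + (norm (snd x))\<^sup>2)"
    by (simp add: power_mult_distrib distrib_left)
  finally have "norm (map_prod B\<^sub>1 B\<^sub>2 x) \<le> sqrt (?m\<^sup>2 * ((norm (fst x))\<^sup>2 + (norm (snd x))\<^sup>2))"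
    by (simp add: norm_prod_def)
  then show "norm (map_prod B\<^sub>1 B\<^sub>2 x) \<le> ?m * norm x"
    using m by (simp add: norm_prod_def real_sqrt_mult)
qed

lemma diag_pseudo_quadratic_subset_pseudo_quadratic:
  "diag_pseudo_quadratic_numerical_range \<Omega> L \<subseteq> pseudo_quadratic_numerical_range \<Omega> L"
proof
  fix z assume z: "z \<in> diag_pseudo_quadratic_numerical_range \<Omega> L"
  show "z \<in> pseudo_quadratic_numerical_range \<Omega> L"
    unfolding pseudo_quadratic_numerical_range_def
  proof
    fix \<epsilon> :: real assume "\<epsilon> \<in> {0<..}"
    then obtain B\<^sub>1 B\<^sub>2 where B: "bounded_clinear B\<^sub>1" "onorm B\<^sub>1 < \<epsilon>" "bounded_clinear B\<^sub>2"
      "onorm B\<^sub>2 < \<epsilon>" "z \<in> quadratic_numerical_range \<Omega> (\<lambda>z. matrix_plus (L z) (map_prod B\<^sub>1 B\<^sub>2))"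
      using z unfolding diag_pseudo_quadratic_numerical_range_def by blast
    have "onorm (map_prod B\<^sub>1 B\<^sub>2) < \<epsilon>"
      using onorm_map_prod_le[of B\<^sub>1 B\<^sub>2] B by (auto simp: bounded_clinear_def)
    then show "z \<in> (\<Union>B\<in>{B. bounded_clinear B \<and> onorm B < \<epsilon>}.
        quadratic_numerical_range \<Omega> (\<lambda>z. matrix_plus (L z) B))"
      using B(5) bounded_clinear_map_prod[OF B(1,3)] by blast
  qed
qed

section \<open>The pointwise statement and the chain of inclusions\<close>

theorem theorem5p1:
  fixes \<Omega> :: "complex set"
    and A :: "complex \<Rightarrow> ('a::complex_hilbert, 'a) operator"
    and B :: "complex \<Rightarrow> ('b::complex_hilbert, 'a) operator"
    and C :: "complex \<Rightarrow> ('a, 'b) operator"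
    and D :: "complex \<Rightarrow> ('b, 'b) operator"
    and L :: "complex \<Rightarrow> ('a, 'b) op_matrix"
    and S\<^sub>1 :: "complex \<Rightarrow> ('a, 'a) operator"
    and S\<^sub>2 :: "complex \<Rightarrow> ('b, 'b) operator"
    and \<rho>A \<rho>D :: "complex set"
    and cond_i cond_ii :: "complex \<Rightarrow> bool"
  assumes nonzero: "\<exists>x::'a. x \<noteq> 0" "\<exists>y::'b. y \<noteq> 0"
    and domain: "open \<Omega>" "connected \<Omega>" "\<Omega> \<noteq> {}"
    and A: "\<And>z. z \<in> \<Omega> \<Longrightarrow> linear_operator (A z) \<and> densely_defined (A z) \<and> closable_operator (A z)"
    and B: "\<And>z. z \<in> \<Omega> \<Longrightarrow> linear_operator (B z) \<and> densely_defined (B z) \<and> closable_operator (B z)"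
    and C: "\<And>z. z \<in> \<Omega> \<Longrightarrow> linear_operator (C z) \<and> densely_defined (C z) \<and> closable_operator (C z)"
    and D: "\<And>z. z \<in> \<Omega> \<Longrightarrow> linear_operator (D z) \<and> densely_defined (D z) \<and> closable_operator (D z)"
    and L: "\<And>z. L z = Op_Matrix (A z) (B z) (C z) (D z)"
    and L_dense: "\<And>z. z \<in> \<Omega> \<Longrightarrow> densely_defined (matrix_operator (L z))"
    and S\<^sub>1: "\<And>z. S\<^sub>1 z = schur1 (L z)"
    and S\<^sub>2: "\<And>z. S\<^sub>2 z = schur2 (L z)"
    and \<rho>A: "\<rho>A = fam_resolvent_set \<Omega> A"
    and \<rho>D: "\<rho>D = fam_resolvent_set \<Omega> D"
    and cond_i: "\<And>z. cond_i z \<longleftrightarrow> C z bounded_relative_to A z \<and> B z bounded_relative_to D z"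
    and cond_ii: "\<And>z. cond_ii z \<longleftrightarrow> A z bounded_relative_to C z \<and> D z bounded_relative_to B z \<and>
      boundedly_invertible (C z) \<and> boundedly_invertible (B z)"
  shows "(\<forall>z \<in> approx_point_spectrum \<Omega> (\<lambda>z. matrix_operator (L z)) -
        (fam_spectrum \<Omega> A \<union> fam_spectrum \<Omega> D).
      cond_i z \<or> cond_ii z \<longrightarrow>
        z \<in> approx_point_spectrum \<rho>D S\<^sub>1 \<union> approx_point_spectrum \<rho>A S\<^sub>2) \<and>
    ((\<forall>z \<in> \<rho>A \<inter> \<rho>D. cond_i z \<or> cond_ii z) \<longrightarrow>
      approx_point_spectrum \<Omega> (\<lambda>z. matrix_operator (L z)) -
          (fam_spectrum \<Omega> A \<union> fam_spectrum \<Omega> D)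
        \<subseteq> approx_point_spectrum \<rho>D S\<^sub>1 \<union> approx_point_spectrum \<rho>A S\<^sub>2 \<and>
      approx_point_spectrum \<rho>D S\<^sub>1 \<union> approx_point_spectrum \<rho>A S\<^sub>2
        \<subseteq> pseudo_numerical_range \<rho>D S\<^sub>1 \<union> pseudo_numerical_range \<rho>A S\<^sub>2 \<and>
      pseudo_numerical_range \<rho>D S\<^sub>1 \<union> pseudo_numerical_range \<rho>A S\<^sub>2
        \<subseteq> diag_pseudo_quadratic_numerical_range \<Omega> L \<and>
      diag_pseudo_quadratic_numerical_range \<Omega> L
        \<subseteq> pseudo_quadratic_numerical_range \<Omega> L)"
proof -
  have S: "S\<^sub>1 = (\<lambda>z. schur1 (L z))" "S\<^sub>2 = (\<lambda>z. schur2 (L z))"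
    using S\<^sub>1 S\<^sub>2 by auto
  have \<rho>: "\<rho>A = fam_resolvent_set \<Omega> (\<lambda>z. entry_A (L z))"
    "\<rho>D = fam_resolvent_set \<Omega> (\<lambda>z. entry_D (L z))"
    by (simp_all add: \<rho>A \<rho>D L)
  have lin: "linear_entries (L z)" if "z \<in> \<Omega>" for z
    using that A B C D by (simp add: linear_entries_def L)
  \<comment> \<open>The approximate point spectrum is a subset of \<open>\<Omega>\<close>, and
    within \<open>\<Omega>\<close> the complement of a spectrum is the resolvent set.\<close>
  have in_\<rho>: "z \<in> \<rho>A \<inter> \<rho>D"
    if "z \<in> approx_point_spectrum \<Omega> (\<lambda>z. matrix_operator (L z)) -
      (fam_spectrum \<Omega> A \<union> fam_spectrum \<Omega> D)" for z
    using that by (auto simp: \<rho>A \<rho>D fam_resolvent_set_def approx_point_spectrum_def)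
  have pointwise: "z \<in> approx_point_spectrum \<rho>D S\<^sub>1 \<union> approx_point_spectrum \<rho>A S\<^sub>2"
    if z: "z \<in> approx_point_spectrum \<Omega> (\<lambda>z. matrix_operator (L z)) -
      (fam_spectrum \<Omega> A \<union> fam_spectrum \<Omega> D)" and c: "cond_i z \<or> cond_ii z" for z
  proof -
    have r: "z \<in> \<Omega>" "boundedly_invertible (A z)" "boundedly_invertible (D z)"
      using in_\<rho>[OF z] by (auto simp: \<rho>A \<rho>D mem_fam_resolvent_set_iff)
    show ?thesis
      unfolding S
      \<comment> \<open>Condition (i) yields the first disjunct of both \<open>cond1\<close> and
        \<open>cond2\<close>, condition (ii) the second of both.\<close>
      by (rule approx_point_spectrum_matrix_subset_schur[of z \<Omega> L])
        (use z c r in_\<rho>[OF z] lin[OF r(1)] in \<open>auto simp: L cond_i cond_ii\<close>)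
  qed
  have incl: "approx_point_spectrum \<Omega> (\<lambda>z. matrix_operator (L z)) -
      (fam_spectrum \<Omega> A \<union> fam_spectrum \<Omega> D)
      \<subseteq> approx_point_spectrum \<rho>D S\<^sub>1 \<union> approx_point_spectrum \<rho>A S\<^sub>2"
    if "\<forall>z \<in> \<rho>A \<inter> \<rho>D. cond_i z \<or> cond_ii z"
    using that pointwise in_\<rho> by blast
  have "pseudo_numerical_range \<rho>D S\<^sub>1 \<union> pseudo_numerical_range \<rho>A S\<^sub>2
      \<subseteq> diag_pseudo_quadratic_numerical_range \<Omega> L"
    unfolding S \<rho> by (rule pseudo_numerical_range_schur_subset_diag[OF nonzero lin L_dense])
  then show ?thesis
    using pointwise incl diag_pseudo_quadratic_subset_pseudo_quadratic[of \<Omega> L]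
      approx_point_spectrum_subset_pseudo_numerical_range[of \<rho>D S\<^sub>1]
      approx_point_spectrum_subset_pseudo_numerical_range[of \<rho>A S\<^sub>2]
    by (intro conjI ballI impI Un_mono) blast+
qed

end
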